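(* Let $G$ be a connected graph that is not a cycle, with $m\ge 1$ edges, $n$ vertices, $h$ heavy edges, and $\ell$ leaves. If every heavy vertex in $G$ is adjacent to at least three light vertices, then $P(G)=\ell+m-h-n$.
   Context: Graphs are finite and simple. A path covering of a graph $G$ is a set of vertex-disjoint paths of $G$ (a single vertex counts as a path) containing all the vertices of $G$; the path covering number $P(G)$ is the minimum number of paths in a path covering of $G$. A leaf is a vertex of degree $1$. A vertex is heavy if its degree is greater than $2$, and light otherwise. A heavy edge is an edge both of whose endpoints are heavy vertices. *)

theory Defs
  imports
    "Graph_Theory.Pair_Digraph"
    "Graph_Theory.Digraph_Component"
    "Graph_Theory.Vertex_Walk"
begin

text \<open>
  A finite simple graph is a \<^locale>\<open>pair_graph\<close>: a finite, loopless, symmetric set of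
  pairs over a finite vertex set. Each undirected edge \<open>uv\<close> is present as the two arcs
  \<open>(u, v)\<close> and \<open>(v, u)\<close>, so edges are counted as two-element vertex sets, not as arcs.
\<close>

definition uedges :: "'a pair_pre_digraph \<Rightarrow> 'a set set" where
  "uedges G = {{u, v} | u v. (u, v) \<in> parcs G}"

text \<open>By symmetry, the out-degree of a vertex is the number of its neighbours.\<close>

definition degree :: "'a pair_pre_digraph \<Rightarrow> 'a \<Rightarrow> nat" where
  "degree G v = out_degree (with_proj G) v"

definition leaves :: "'a pair_pre_digraph \<Rightarrow> 'a set" where
  "leaves G = {v \<in> pverts G. degree G v = 1}"

definition heavy :: "'a pair_pre_digraph \<Rightarrow> 'a \<Rightarrow> bool" where
  "heavy G v \<longleftrightarrow> v \<in> pverts G \<and> degree G v > 2"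

definition light :: "'a pair_pre_digraph \<Rightarrow> 'a \<Rightarrow> bool" where
  "light G v \<longleftrightarrow> v \<in> pverts G \<and> \<not> heavy G v"

definition heavy_edges :: "'a pair_pre_digraph \<Rightarrow> 'a set set" where
  "heavy_edges G = {e \<in> uedges G. \<forall>v \<in> e. heavy G v}"

text \<open>
  The whole graph is a cycle. The library's \<open>cycle\<close> is a closed arc walk, which in a
  symmetric digraph includes \<open>u, v, u\<close>; hence the explicit length bound here.
\<close>

definition is_cycle_graph :: "'a pair_pre_digraph \<Rightarrow> bool" where
  "is_cycle_graph G \<longleftrightarrow>
     (\<exists>vs. distinct vs \<and> length vs \<ge> 3 \<and> pverts G = set vs \<and>
       uedges G = {{vs ! i, vs ! (Suc i mod length vs)} | i. i < length vs})"

text \<open>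
  A path is a nonempty duplicate-free list of successively adjacent vertices
  (\<^const>\<open>vpath\<close>); it need not be an induced subgraph. A path and its reversal share their
  vertices, so a disjoint family contains at most one of the two lists unless they coincide.
\<close>

definition path_covering :: "'a pair_pre_digraph \<Rightarrow> 'a list set \<Rightarrow> bool" where
  "path_covering G C \<longleftrightarrow>
     finite C \<and> (\<forall>p \<in> C. vpath p (with_proj G)) \<and>
     pairwise (\<lambda>p q. set p \<inter> set q = {}) C \<and>
     (\<Union>p\<in>C. set p) = pverts G"

definition path_covering_number :: "'a pair_pre_digraph \<Rightarrow> nat" where
  "path_covering_number G = (LEAST k. \<exists>C. path_covering G C \<and> card C = k)"

lemma (in pair_graph) path_covering_singletons:
  "path_covering G ((\<lambda>v. [v]) ` pverts G)"
  unfolding path_covering_def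
proof (intro conjI ballI)
  show "finite ((\<lambda>v. [v]) ` pverts G)"
    using pair_finite_verts by (rule finite_imageI)
next
  fix p assume "p \<in> (\<lambda>v. [v]) ` pverts G"
  then obtain v where "p = [v]" "v \<in> pverts G" by blast
  then show "vpath p (with_proj G)"
    by (simp only: vpath_def vwalk_def) simp
next
  show "pairwise (\<lambda>p q. set p \<inter> set q = {}) ((\<lambda>v. [v]) ` pverts G)"
    unfolding pairwise_def by force
next
  show "(\<Union>p\<in>(\<lambda>v. [v]) ` pverts G. set p) = pverts G" by force
qed

lemma (in pair_graph) path_covering_number_attained:
  "\<exists>C. path_covering G C \<and> card C = path_covering_number G"
  unfolding path_covering_number_def
  by (rule LeastI_ex) (use path_covering_singletons in metis)

lemma path_covering_number_le:
  "path_covering G C \<Longrightarrow> path_covering_number G \<le> card C"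
  unfolding path_covering_number_def by (rule Least_le) metis

end

theory Submission
  imports Defs
begin

text \<open>
  Let \<open>H\<close> be the set of heavy vertices and \<open>k\<close> the number of edges with two light ends. A covering
  by \<open>c\<close> paths uses \<open>n - c\<close> edges, of which at most \<open>k\<close> join light vertices and at most two meet
  any given heavy vertex, so \<open>c \<ge> n - k - 2 |H|\<close>. For the converse, start with a smallest covering
  in which every heavy vertex is a path of its own; as \<open>G\<close> is not a cycle, it uses all \<open>k\<close>
  light edges. A light neighbour of a heavy vertex \<open>v\<close> that is still alone is an end of its path,
  so three of them cannot lie on one path, and \<open>v\<close> can be used to link two different paths. Doing
  this for every heavy vertex gives \<open>n - k - 2 |H|\<close> paths. Counting the edge ends at light vertices
  shows that this number is \<open>l + m - h - n\<close>.
\<close>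

section \<open>Paths, their edges, and path coverings\<close>

definition nbrs :: "'a pair_pre_digraph \<Rightarrow> 'a \<Rightarrow> 'a set" where
  "nbrs G v = {u. (v, u) \<in> parcs G}"

definition path_edges :: "'a list \<Rightarrow> 'a set set" where
  "path_edges p = {{p ! i, p ! Suc i} | i. Suc i < length p}"

definition light_edges :: "'a pair_pre_digraph \<Rightarrow> 'a set set" where
  "light_edges G = {e \<in> uedges G. \<forall>v \<in> e. light G v}"

lemma path_edges_image: "path_edges p = (\<lambda>i. {p ! i, p ! Suc i}) ` {..<length p - 1}"
  unfolding path_edges_def by auto

lemma finite_path_edges: "finite (path_edges p)"
  by (simp add: path_edges_image)

lemma path_edges_subset: "e \<in> path_edges p \<Longrightarrow> e \<subseteq> set p"
  unfolding path_edges_def by auto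

lemma path_edges_nonempty: "e \<in> path_edges p \<Longrightarrow> e \<noteq> {}"
  unfolding path_edges_def by auto

lemma card_path_edges:
  assumes "distinct p"
  shows "card (path_edges p) = length p - 1"
proof -
  have "inj_on (\<lambda>i. {p ! i, p ! Suc i}) {..<length p - 1}"
    by (rule inj_onI) (use assms in \<open>auto simp: doubleton_eq_iff nth_eq_iff_index_eq\<close>)
  then show ?thesis by (simp add: path_edges_image card_image)
qed

lemma card_path_edges_at:
  assumes "distinct p"
  shows "card {e \<in> path_edges p. v \<in> e} \<le> 2"
proof (cases "v \<in> set p")
  case True
  then obtain i where i: "i < length p" "v = p ! i" by (metis in_set_conv_nth)
  \<comment> \<open>At the ends of the path one of the two listed sets is junk: \<open>i - 1\<close>
    is \<open>0\<close> for \<open>i = 0\<close>, and \<open>Suc i\<close> may be out of range. This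
    is harmless, since only an upper bound is needed.\<close>
  have "{e \<in> path_edges p. v \<in> e} \<subseteq> {{p ! i, p ! Suc i}, {p ! (i - 1), p ! i}}"
  proof
    fix e assume e: "e \<in> {e \<in> path_edges p. v \<in> e}"
    then obtain j where j: "e = {p ! j, p ! Suc j}" "Suc j < length p"
      unfolding path_edges_def by auto
    have "j = i \<or> Suc j = i"
      using e i j assms by (auto simp: nth_eq_iff_index_eq)
    then show "e \<in> {{p ! i, p ! Suc i}, {p ! (i - 1), p ! i}}"
      using j by auto
  qed
  then have "card {e \<in> path_edges p. v \<in> e} \<le> card {{p ! i, p ! Suc i}, {p ! (i - 1), p ! i}}"
    by (intro card_mono) auto
  also have "\<dots> \<le> 2" by (simp add: card_insert_if)
  finally show ?thesis .
next
  case False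
  then have none: "{e \<in> path_edges p. v \<in> e} = {}" using path_edges_subset by fastforce
  show ?thesis unfolding none by simp
qed

text \<open>Replaces the arc list of a walk by \<open>successively\<close>, which behaves well under
  \<open>rev\<close> and \<open>@\<close>; reversing and concatenating paths relies on this.\<close>

lemma set_vwalk_arcs_subset_iff:
  "set (vwalk_arcs p) \<subseteq> A \<longleftrightarrow> successively (\<lambda>a b. (a, b) \<in> A) p"
  by (induction p rule: vwalk_arcs.induct) auto

lemma vpath_iff:
  "vpath p (with_proj G) \<longleftrightarrow>
    p \<noteq> [] \<and> distinct p \<and> set p \<subseteq> pverts G \<and> successively (\<lambda>a b. (a, b) \<in> parcs G) p"
  unfolding vpath_def vwalk_def by (auto simp: set_vwalk_arcs_subset_iff)

lemma vpath_nth_arc: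
  "vpath p (with_proj G) \<Longrightarrow> Suc i < length p \<Longrightarrow> (p ! i, p ! Suc i) \<in> parcs G"
  by (simp add: vpath_iff successively_conv_nth)

lemma path_edges_uedges:
  "vpath p (with_proj G) \<Longrightarrow> path_edges p \<subseteq> uedges G"
  unfolding path_edges_def uedges_def using vpath_nth_arc by fastforce

lemma path_covering_vpath: "path_covering G C \<Longrightarrow> p \<in> C \<Longrightarrow> vpath p (with_proj G)"
  by (simp add: path_covering_def)

lemma path_covering_disjoint:
  "path_covering G C \<Longrightarrow> p \<in> C \<Longrightarrow> q \<in> C \<Longrightarrow> x \<in> set p \<Longrightarrow> x \<in> set q \<Longrightarrow> p = q"
  unfolding path_covering_def pairwise_def by blast

lemma path_covering_set_disjoint:
  "path_covering G C \<Longrightarrow> p \<in> C \<Longrightarrow> q \<in> C \<Longrightarrow> p \<noteq> q \<Longrightarrow> set p \<inter> set q = {}"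
  unfolding path_covering_def pairwise_def by blast

lemma path_covering_singleton:
  "path_covering G C \<Longrightarrow> [v] \<in> C \<Longrightarrow> p \<in> C \<Longrightarrow> v \<in> set p \<Longrightarrow> p = [v]"
  using path_covering_disjoint by fastforce

lemma path_covering_obtain:
  assumes "path_covering G C" "v \<in> pverts G"
  obtains p where "p \<in> C" "v \<in> set p"
  using assms unfolding path_covering_def by blast

text \<open>A path has one edge fewer than vertices. Edges are nonempty subsets of the vertex set of
  their path, so disjoint paths share none and the counts add up.\<close>

lemma path_covering_card:
  assumes C: "path_covering G C"
  shows "card C + card (\<Union>p\<in>C. path_edges p) = card (pverts G)"
proof -
  have fin: "finite C" and disj: "pairwise (\<lambda>p q. set p \<inter> set q = {}) C"
    and un: "(\<Union>p\<in>C. set p) = pverts G"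
    using C by (auto simp: path_covering_def)
  have len: "1 + card (path_edges p) = card (set p)" if "p \<in> C" for p
    using path_covering_vpath[OF C that]
    by (cases p) (auto simp: vpath_iff card_path_edges distinct_card)
  have "card (\<Union>p\<in>C. path_edges p) = (\<Sum>p\<in>C. card (path_edges p))"
  proof (rule card_UN_disjoint)
    show "\<forall>p\<in>C. \<forall>q\<in>C. p \<noteq> q \<longrightarrow> path_edges p \<inter> path_edges q = {}"
    proof (intro ballI impI)
      fix p q assume "p \<in> C" "q \<in> C" "p \<noteq> q"
      then have "set p \<inter> set q = {}" using disj by (auto simp: pairwise_def)
      then show "path_edges p \<inter> path_edges q = {}"
        using path_edges_subset path_edges_nonempty by blast
    qed
  qed (use fin finite_path_edges in auto)
  moreover have "card (\<Union>p\<in>C. set p) = (\<Sum>p\<in>C. card (set p))"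
    by (rule card_UN_disjoint) (use fin disj in \<open>auto simp: pairwise_def\<close>)
  moreover have "(\<Sum>p\<in>C. card (set p)) = (\<Sum>p\<in>C. 1 + card (path_edges p))"
    by (rule sum.cong) (simp_all only: len)
  then have "(\<Sum>p\<in>C. card (set p)) = card C + (\<Sum>p\<in>C. card (path_edges p))"
    by (simp only: sum.distrib) simp
  ultimately show ?thesis using un by simp
qed

context pair_graph
begin

section \<open>Neighbourhoods, ends of paths, and joining paths\<close>

lemma finite_nbrs: "finite (nbrs G v)"
proof -
  have "nbrs G v \<subseteq> pverts G" unfolding nbrs_def using in_arcsD2 by blast
  then show ?thesis using pair_finite_verts finite_subset by blast
qed

lemma degree_eq_card_nbrs: "degree G v = card (nbrs G v)"
proof -
  have "out_arcs (with_proj G) v = Pair v ` nbrs G v"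
    unfolding out_arcs_def nbrs_def by auto
  then show ?thesis
    by (simp add: degree_def out_degree_def card_image inj_on_def)
qed

lemma light_iff: "light G v \<longleftrightarrow> v \<in> pverts G \<and> card (nbrs G v) \<le> 2"
  by (auto simp: light_def heavy_def degree_eq_card_nbrs)

lemma light_or_heavy: "v \<in> pverts G \<Longrightarrow> light G v \<or> heavy G v"
  by (auto simp: light_def)

lemma light_not_heavy: "light G v \<Longrightarrow> \<not> heavy G v"
  by (simp add: light_def)

lemma finite_uedges: "finite (uedges G)"
proof -
  have "uedges G = (\<lambda>(u, v). {u, v}) ` parcs G" unfolding uedges_def by force
  then show ?thesis using pair_finite_arcs by simp
qed

lemma vpath_rev: "vpath p (with_proj G) \<Longrightarrow> vpath (rev p) (with_proj G)"
  by (auto simp: vpath_iff successively_rev elim!: successively_mono dest: arcs_symmetric)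

text \<open>An inner vertex already has two neighbours along \<open>p\<close>. As the edge to
  \<open>w\<close> is not on the path, \<open>w\<close> would be a third one, even if
  \<open>w\<close> itself lies on \<open>p\<close>; a light vertex has at most two.\<close>

lemma light_nbr_endpoint:
  assumes p: "vpath p (with_proj G)" and u: "u \<in> set p" "light G u"
    and uw: "(u, w) \<in> parcs G" "{u, w} \<notin> path_edges p"
  shows "u = hd p \<or> u = last p"
proof (rule ccontr)
  assume not_end: "\<not> (u = hd p \<or> u = last p)"
  obtain i where i: "i < length p" "u = p ! i" using u(1) by (metis in_set_conv_nth)
  have ne: "p \<noteq> []" using u(1) by auto
  obtain j where j: "i = Suc j" using not_end i ne by (cases i) (auto simp: hd_conv_nth)
  have Si: "Suc i < length p"
    using not_end i last_conv_nth[OF ne] by (metis Suc_lessI diff_Suc_1)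
  have "p ! j \<in> nbrs G u" "p ! Suc i \<in> nbrs G u" "w \<in> nbrs G u"
    using vpath_nth_arc[OF p, of j] vpath_nth_arc[OF p, of i] arcs_symmetric uw(1) i j Si
    by (auto simp: nbrs_def)
  then have sub: "{p ! j, p ! Suc i, w} \<subseteq> nbrs G u" by simp
  have "{u, p ! j} \<in> path_edges p" "{u, p ! Suc i} \<in> path_edges p"
    unfolding path_edges_def using i j Si by auto
  then have "w \<noteq> p ! j" "w \<noteq> p ! Suc i" using uw(2) by auto
  moreover have "p ! j \<noteq> p ! Suc i"
    using p i j Si by (auto simp: vpath_iff nth_eq_iff_index_eq)
  ultimately have "card {p ! j, p ! Suc i, w} = 3" by auto
  then show False using card_mono[OF finite_nbrs sub] u(2) by (simp add: light_iff)
qed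

lemma vpath_orient:
  assumes "vpath p (with_proj G)" "u \<in> {hd p, last p}"
  obtains q where "vpath q (with_proj G)" "set q = set p" "last q = u"
    "{hd q, last q} = {hd p, last p}"
proof (cases "u = last p")
  case True
  then show ?thesis using assms that by blast
next
  case False
  then have "u = hd p" using assms by auto
  moreover have "p \<noteq> []" using assms by (simp add: vpath_iff)
  ultimately show ?thesis
    using that[of "rev p"] vpath_rev[OF assms(1)] by (auto simp: hd_rev last_rev)
qed

text \<open>Both paths are oriented to end at the linking edge, and the second is then reversed. The
  last conclusion concerns a one-vertex path \<open>q\<close>: its vertex becomes an end of the new
  path and can be linked a second time.\<close>

lemma vpath_join:
  assumes p: "vpath p (with_proj G)" and q: "vpath q (with_proj G)"
    and disj: "set p \<inter> set q = {}"
    and u: "u \<in> {hd p, last p}" and v: "v \<in> {hd q, last q}" and uv: "(u, v) \<in> parcs G"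
  obtains r where "vpath r (with_proj G)" "set r = set p \<union> set q"
    "hd q = last q \<longrightarrow> last r = v"
proof -
  obtain p' where p': "vpath p' (with_proj G)" "set p' = set p" "last p' = u"
    using vpath_orient[OF p u] by metis
  obtain q' where q': "vpath q' (with_proj G)" "set q' = set q" "last q' = v"
    "{hd q', last q'} = {hd q, last q}"
    using vpath_orient[OF q v] by metis
  have "vpath (p' @ rev q') (with_proj G)"
    using p' vpath_rev[OF q'(1)] q' disj uv
    by (auto simp: vpath_iff successively_append_iff hd_rev)
  moreover have "set (p' @ rev q') = set p \<union> set q" using p' q' by simp
  moreover have "last (p' @ rev q') = hd q'"
    using q'(1) by (simp add: vpath_iff last_rev)
  then have "hd q = last q \<longrightarrow> last (p' @ rev q') = v"
    using q'(4) v by auto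
  ultimately show ?thesis by (rule that)
qed

lemma path_covering_join:
  assumes C: "path_covering G C" and pq: "p \<in> C" "q \<in> C" "p \<noteq> q"
    and u: "u \<in> {hd p, last p}" and v: "v \<in> {hd q, last q}" and uv: "(u, v) \<in> parcs G"
  obtains r where "path_covering G (insert r (C - {p, q}))"
    "Suc (card (insert r (C - {p, q}))) = card C"
    "set r = set p \<union> set q" "hd q = last q \<longrightarrow> last r = v"
proof -
  have disj: "set p \<inter> set q = {}" using path_covering_set_disjoint[OF C pq] .
  obtain r where r: "vpath r (with_proj G)" "set r = set p \<union> set q"
    "hd q = last q \<longrightarrow> last r = v"
    by (rule vpath_join[OF path_covering_vpath[OF C pq(1)] path_covering_vpath[OF C pq(2)] disj u v uv])
  have fin: "finite C" using C by (simp add: path_covering_def)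
  have rd: "set r \<inter> set s = {}" if "s \<in> C - {p, q}" for s
  proof -
    have s: "s \<in> C" "p \<noteq> s" "q \<noteq> s" using that by blast+
    have "set p \<inter> set s = {}" "set q \<inter> set s = {}"
      by (rule path_covering_set_disjoint[OF C pq(1) s(1,2)],
          rule path_covering_set_disjoint[OF C pq(2) s(1,3)])
    then show ?thesis using r(2) by (simp add: Int_Un_distrib2)
  qed
  \<comment> \<open>\<open>r\<close> is nonempty and disjoint from every remaining path, hence not
    one of them; so the number of paths drops by exactly one.\<close>
  have rne: "set r \<noteq> {}" using r(1) by (simp add: vpath_iff)
  then have rn: "r \<notin> C - {p, q}" using rd[of r] by auto
  have "path_covering G (insert r (C - {p, q}))"
    unfolding path_covering_def
  proof (intro conjI)
    show "pairwise (\<lambda>p q. set p \<inter> set q = {}) (insert r (C - {p, q}))"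
    proof -
      have "pairwise (\<lambda>p q. set p \<inter> set q = {}) (C - {p, q})"
        using C unfolding path_covering_def by (meson Diff_subset pairwise_subset)
      then show ?thesis using rd by (simp add: pairwise_insert Int_commute)
    qed
    show "(\<Union>s\<in>insert r (C - {p, q}). set s) = pverts G"
    proof -
      have "(\<Union>s\<in>insert r (C - {p, q}). set s) = (\<Union>s\<in>insert p (insert q (C - {p, q})). set s)"
        using r(2) by auto
      also have "insert p (insert q (C - {p, q})) = C" using pq by blast
      finally show ?thesis using C by (simp add: path_covering_def)
    qed
    show "\<forall>s\<in>insert r (C - {p, q}). vpath s (with_proj G)"
      using path_covering_vpath[OF C] r(1) by blast
    show "finite (insert r (C - {p, q}))" using fin by simp
  qed
  moreover have "Suc (card (insert r (C - {p, q}))) = card C"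
  proof -
    have "card (C - {p, q}) = card C - card {p, q}"
      using pq fin by (intro card_Diff_subset) auto
    moreover have "card {p, q} \<le> card C" using pq fin by (intro card_mono) auto
    ultimately show ?thesis using rn fin pq by simp
  qed
  ultimately show ?thesis using r(2,3) by (rule that)
qed

section \<open>The lower bound for coverings\<close>

lemma card_edges_at_le:
  assumes C: "path_covering G C"
  shows "card {e \<in> (\<Union>p\<in>C. path_edges p). v \<in> e} \<le> 2"
proof (cases "v \<in> pverts G")
  case True
  then obtain p where p: "p \<in> C" "v \<in> set p" using path_covering_obtain[OF C] by blast
  have "{e \<in> (\<Union>p\<in>C. path_edges p). v \<in> e} \<subseteq> {e \<in> path_edges p. v \<in> e}"
  proof
    fix e assume "e \<in> {e \<in> (\<Union>p\<in>C. path_edges p). v \<in> e}"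
    then obtain q where q: "q \<in> C" "e \<in> path_edges q" "v \<in> e" by auto
    then have "q = p" using path_edges_subset path_covering_disjoint[OF C] p by blast
    then show "e \<in> {e \<in> path_edges p. v \<in> e}" using q by simp
  qed
  then have "card {e \<in> (\<Union>p\<in>C. path_edges p). v \<in> e} \<le> card {e \<in> path_edges p. v \<in> e}"
    by (intro card_mono finite_subset[OF _ finite_path_edges[of p]]) auto
  also have "\<dots> \<le> 2"
    using card_path_edges_at path_covering_vpath[OF C p(1)] by (auto simp: vpath_iff)
  finally show ?thesis .
next
  case False
  have "e \<subseteq> pverts G" if "e \<in> (\<Union>p\<in>C. path_edges p)" for e
    using that C path_edges_subset unfolding path_covering_def by blast
  then have none: "{e \<in> (\<Union>p\<in>C. path_edges p). v \<in> e} = {}" using False by blast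
  show ?thesis unfolding none by simp
qed

lemma finite_heavy: "finite {v. heavy G v}"
  using pair_finite_verts by (rule rev_finite_subset) (auto simp: heavy_def)

lemma finite_light_edges: "finite (light_edges G)"
  using finite_uedges by (simp add: light_edges_def)

lemma uedges_subset_pverts: "e \<in> uedges G \<Longrightarrow> e \<subseteq> pverts G"
  unfolding uedges_def using in_arcsD1 in_arcsD2 by auto

lemma path_covering_card_ge:
  assumes C: "path_covering G C"
  shows "card (pverts G) \<le> card C + card (light_edges G) + 2 * card {v. heavy G v}"
proof -
  define F where "F = (\<Union>p\<in>C. path_edges p)"
  have F: "F \<subseteq> uedges G"
    unfolding F_def using path_edges_uedges path_covering_vpath[OF C] by blast
  \<comment> \<open>The sets on the right may overlap: an edge of \<open>F\<close> with two heavy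
    ends is counted at both. For an upper bound on \<open>card F\<close> this does not
    matter.\<close>
  have "F \<subseteq> light_edges G \<union> (\<Union>v\<in>{v. heavy G v}. {e \<in> F. v \<in> e})"
  proof
    fix e assume e: "e \<in> F"
    then have "e \<in> uedges G" "e \<subseteq> pverts G" using F uedges_subset_pverts by auto
    then show "e \<in> light_edges G \<union> (\<Union>v\<in>{v. heavy G v}. {e \<in> F. v \<in> e})"
      using e light_or_heavy unfolding light_edges_def by blast
  qed
  moreover have "finite F" using F finite_uedges finite_subset by blast
  ultimately have "card F \<le> card (light_edges G \<union> (\<Union>v\<in>{v. heavy G v}. {e \<in> F. v \<in> e}))"
    using finite_light_edges finite_heavy by (intro card_mono) auto
  also have "\<dots> \<le> card (light_edges G) + card (\<Union>v\<in>{v. heavy G v}. {e \<in> F. v \<in> e})"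
    by (rule card_Un_le)
  also have "card (\<Union>v\<in>{v. heavy G v}. {e \<in> F. v \<in> e}) \<le> (\<Sum>v\<in>{v. heavy G v}. card {e \<in> F. v \<in> e})"
    using finite_heavy by (rule card_UN_le)
  also have "\<dots> \<le> (\<Sum>v\<in>{v. heavy G v}. 2)"
    using card_edges_at_le[OF C] unfolding F_def by (intro sum_mono) auto
  also have "\<dots> = 2 * card {v. heavy G v}" by simp
  finally show ?thesis using path_covering_card[OF C] unfolding F_def by linarith
qed

section \<open>Connectedness and the cycle case\<close>

text \<open>Arcs are symmetric, so connectedness makes every vertex reachable from \<open>x\<close>,
  and membership in \<open>S\<close> propagates along the walk.\<close>

lemma connected_closed_set:
  assumes conn: "Digraph_Component.connected (with_proj G)"
    and S: "x \<in> S" "x \<in> pverts G" and closed: "\<And>u w. u \<in> S \<Longrightarrow> (u, w) \<in> parcs G \<Longrightarrow> w \<in> S"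
  shows "pverts G \<subseteq> S"
proof
  fix y assume y: "y \<in> pverts G"
  have "strongly_connected (with_proj G)"
    using symmetric_connected_imp_strongly_connected pair_sym_arcs conn by blast
  then have "x \<rightarrow>\<^sup>*\<^bsub>with_proj G\<^esub> y" using S(2) y by (auto simp: strongly_connected_def)
  then show "y \<in> S"
    by (induction rule: reachable_induct) (use S closed in auto)
qed

text \<open>Every vertex of the closed path has its two cyclic neighbours and, being light, no
  others. Hence no arc leaves the path, which by connectedness is the whole graph.\<close>

lemma light_closed_path_is_cycle:
  assumes conn: "Digraph_Component.connected (with_proj G)"
    and p: "vpath p (with_proj G)" and len: "length p \<ge> 3"
    and light: "\<And>v. v \<in> set p \<Longrightarrow> light G v"
    and closing: "(last p, hd p) \<in> parcs G"
  shows "is_cycle_graph G"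
proof -
  let ?k = "length p"
  have dist: "distinct p" and sub: "set p \<subseteq> pverts G" and ne: "p \<noteq> []"
    using p by (auto simp: vpath_iff)
  have arc: "(p ! i, p ! (Suc i mod ?k)) \<in> parcs G" if "i < ?k" for i
  proof (cases "Suc i = ?k")
    case True
    then have "i = ?k - 1" by simp
    then show ?thesis using closing True ne by (simp add: last_conv_nth hd_conv_nth)
  next
    case False
    then show ?thesis using vpath_nth_arc[OF p, of i] that by simp
  qed
  have edge: "\<exists>i<?k. {u, w} = {p ! i, p ! (Suc i mod ?k)}"
    if u: "u \<in> set p" and uw: "(u, w) \<in> parcs G" for u w
  proof -
    obtain i where i: "i < ?k" "u = p ! i" using u by (metis in_set_conv_nth)
    \<comment> \<open>The cyclic predecessor of \<open>i\<close>. It differs from the cyclic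
      successor because the length is at least 3.\<close>
    define j where "j = (if i = 0 then ?k - 1 else i - 1)"
    have j: "j < ?k" "Suc j mod ?k = i" "j \<noteq> Suc i mod ?k"
      using i len by (auto simp: j_def mod_Suc)
    have "p ! (Suc i mod ?k) \<in> nbrs G u" "p ! j \<in> nbrs G u"
      using arc[OF i(1)] arc[OF j(1)] j(2) i(2) arcs_symmetric by (auto simp: nbrs_def)
    then have subn: "{p ! (Suc i mod ?k), p ! j} \<subseteq> nbrs G u" by simp
    have "Suc i mod ?k < ?k" using ne by simp
    then have "card {p ! (Suc i mod ?k), p ! j} = 2"
      using dist j by (auto simp: nth_eq_iff_index_eq)
    then have "{p ! (Suc i mod ?k), p ! j} = nbrs G u"
      using light[OF u] subn finite_nbrs by (intro card_seteq) (auto simp: light_iff)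
    then have "w = p ! (Suc i mod ?k) \<or> w = p ! j" using uw by (auto simp: nbrs_def)
    then show ?thesis using i j by (metis insert_commute)
  qed
  have "w \<in> set p" if u: "u \<in> set p" and uw: "(u, w) \<in> parcs G" for u w
  proof -
    obtain i where i: "i < ?k" "{u, w} = {p ! i, p ! (Suc i mod ?k)}" using edge[OF u uw] by blast
    have "Suc i mod ?k < ?k" using ne by simp
    then have "{p ! i, p ! (Suc i mod ?k)} \<subseteq> set p" using i by simp
    then show ?thesis using i(2) by blast
  qed
  moreover have "hd p \<in> set p" using ne by simp
  moreover have "hd p \<in> pverts G" using ne sub by auto
  ultimately have verts: "pverts G = set p"
    using connected_closed_set[OF conn, of "hd p" "set p"] sub by blast
  have "uedges G = {{p ! i, p ! (Suc i mod ?k)} | i. i < ?k}" (is "_ = ?R")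
  proof
    show "uedges G \<subseteq> ?R"
    proof
      fix e assume "e \<in> uedges G"
      then obtain u w where e: "e = {u, w}" "(u, w) \<in> parcs G" by (auto simp: uedges_def)
      then have "u \<in> set p" using in_arcsD1 verts by blast
      then show "e \<in> ?R" using edge e by blast
    qed
    show "?R \<subseteq> uedges G" unfolding uedges_def using arc by blast
  qed
  then show ?thesis unfolding is_cycle_graph_def using dist len verts by blast
qed

section \<open>Construction of a small covering\<close>

lemma initial_covering:
  assumes conn: "Digraph_Component.connected (with_proj G)" and nc: "\<not> is_cycle_graph G"
  obtains C where "path_covering G C" "\<And>v. heavy G v \<Longrightarrow> [v] \<in> C"
    "card C + card (light_edges G) = card (pverts G)"
proof -
  let ?P = "\<lambda>C. path_covering G C \<and> (\<forall>v. heavy G v \<longrightarrow> [v] \<in> C)"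
  have "?P ((\<lambda>v. [v]) ` pverts G)"
    using path_covering_singletons by (auto simp: heavy_def)
  then obtain C where "?P C" and least: "\<And>D. ?P D \<Longrightarrow> card C \<le> card D"
    using ex_has_least_nat[of ?P _ card] by blast
  then have C: "path_covering G C" and single: "\<And>v. heavy G v \<Longrightarrow> [v] \<in> C" by auto
  have path_light: "light G v" if "p \<in> C" "v \<in> set p" "x \<in> set p" "light G x" for p v x
  proof (rule ccontr)
    assume "\<not> light G v"
    moreover have "v \<in> pverts G" using that C by (auto simp: path_covering_def)
    ultimately have "[v] \<in> C" using light_or_heavy single by blast
    then have "p = [v]" using path_covering_singleton[OF C] that by blast
    then show False using that \<open>\<not> light G v\<close> by simp
  qed
  have "light_edges G \<subseteq> (\<Union>p\<in>C. path_edges p)"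
  proof (rule ccontr)
    assume "\<not> light_edges G \<subseteq> (\<Union>p\<in>C. path_edges p)"
    then obtain u w where uw: "(u, w) \<in> parcs G" "light G u" "light G w"
      and unused: "\<And>p. p \<in> C \<Longrightarrow> {u, w} \<notin> path_edges p"
      unfolding light_edges_def uedges_def by blast
    have wu: "(w, u) \<in> parcs G" using uw(1) arcs_symmetric by blast
    obtain p where p: "p \<in> C" "u \<in> set p"
      using path_covering_obtain[OF C] uw(2) by (auto simp: light_iff)
    obtain q where q: "q \<in> C" "w \<in> set q"
      using path_covering_obtain[OF C] uw(3) by (auto simp: light_iff)
    have u_end: "u \<in> {hd p, last p}"
      using light_nbr_endpoint[OF path_covering_vpath[OF C p(1)] p(2) uw(2,1) unused[OF p(1)]]
      by auto
    have w_end: "w \<in> {hd q, last q}"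
      using light_nbr_endpoint[OF path_covering_vpath[OF C q(1)] q(2) uw(3) wu] unused[OF q(1)]
      by (auto simp: insert_commute)
    show False
    proof (cases "p = q")
      case True
      have vp: "vpath p (with_proj G)" using path_covering_vpath[OF C p(1)] .
      have neq: "u \<noteq> w" using uw(1) no_loops' by blast
      have ends: "{u, w} = {hd p, last p}" using u_end w_end neq True by auto
      have "(last p, hd p) \<in> parcs G" using ends uw(1) wu by (auto simp: doubleton_eq_iff)
      \<comment> \<open>The ends \<open>u\<close> and \<open>w\<close> are distinct, so
        \<open>p\<close> has more than one vertex; with exactly two, the edge between them would lie
        on \<open>p\<close>.\<close>
      moreover have "length p \<ge> 3"
      proof (rule ccontr)
        assume "\<not> length p \<ge> 3"
        moreover have "length p \<noteq> 0" "length p \<noteq> 1"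
          using p(2) ends neq by (auto simp: length_Suc_conv)
        ultimately have "length p = 2" by linarith
        then obtain a b where "p = [a, b]" by (auto simp: numeral_2_eq_2 length_Suc_conv)
        then have "{u, w} \<in> path_edges p" using ends by (auto simp: path_edges_def)
        then show False using unused p(1) by blast
      qed
      ultimately have "is_cycle_graph G"
        using light_closed_path_is_cycle[OF conn vp] path_light[OF p(1) _ p(2) uw(2)] by blast
      then show False using nc by blast
    next
      case False
      obtain r where r: "path_covering G (insert r (C - {p, q}))"
        "Suc (card (insert r (C - {p, q}))) = card C"
        using path_covering_join[OF C p(1) q(1) False u_end w_end uw(1)] by blast
      \<comment> \<open>The two joined paths contain the light vertices \<open>u\<close> and
        \<open>w\<close>, so neither of them is the one-vertex path of a heavy vertex.\<close>
      have "[v] \<in> insert r (C - {p, q})" if "heavy G v" for v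
        using single[OF that] p(2) q(2) uw(2,3) that light_not_heavy by auto
      then have "card C \<le> card (insert r (C - {p, q}))" using least r(1) by blast
      then show False using r(2) by simp
    qed
  qed
  moreover have "(\<Union>p\<in>C. path_edges p) \<subseteq> light_edges G"
  proof (intro UN_least subsetI)
    fix p e assume pe: "p \<in> C" "e \<in> path_edges p"
    have "light G v" if "v \<in> e" for v
    proof (rule ccontr)
      assume "\<not> light G v"
      moreover have v: "v \<in> set p" using pe(2) that path_edges_subset by blast
      moreover have "v \<in> pverts G" using v pe(1) C by (auto simp: path_covering_def)
      ultimately have "p = [v]" using light_or_heavy single path_covering_singleton[OF C] pe(1) by blast
      then show False using pe(2) by (simp add: path_edges_def)
    qed
    then show "e \<in> light_edges G"
      using path_edges_uedges[OF path_covering_vpath[OF C pe(1)]] pe(2) by (auto simp: light_edges_def)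
  qed
  ultimately have "(\<Union>p\<in>C. path_edges p) = light_edges G" by blast
  then show ?thesis using that[OF C single] path_covering_card[OF C] by simp
qed

text \<open>While \<open>v\<close> is a path of its own, no edge at \<open>v\<close> is used, so its
  light neighbours are ends of their paths. One path has at most two ends, so three such neighbours
  give two different paths to link through \<open>v\<close>; the two joins save two paths.\<close>

lemma attach_heavy_vertex:
  assumes C: "path_covering G C" and v: "[v] \<in> C" "heavy G v"
    and three: "card {u. (v, u) \<in> parcs G \<and> light G u} \<ge> 3"
  obtains D where "path_covering G D" "card D + 2 = card C"
    "\<And>x. heavy G x \<Longrightarrow> x \<noteq> v \<Longrightarrow> [x] \<in> C \<Longrightarrow> [x] \<in> D"
proof -
  let ?W = "{u. (v, u) \<in> parcs G \<and> light G u}"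
  have W_end: "w \<in> {hd p, last p} \<and> (w, v) \<in> parcs G \<and> p \<noteq> [v]"
    if w: "w \<in> ?W" and p: "p \<in> C" "w \<in> set p" for w p
  proof -
    have wv: "(w, v) \<in> parcs G" "w \<noteq> v" using w arcs_symmetric no_loops' by auto
    have "v \<notin> set p" using path_covering_singleton[OF C v(1) p(1)] p(2) wv(2) by auto
    then have "{w, v} \<notin> path_edges p" using path_edges_subset by blast
    then have "w = hd p \<or> w = last p"
      using light_nbr_endpoint[OF path_covering_vpath[OF C p(1)] p(2)] w wv(1) by blast
    then show ?thesis using wv p by auto
  qed
  obtain w1 where w1: "w1 \<in> ?W" using three by (cases "?W = {}") auto
  then obtain p where p: "p \<in> C" "w1 \<in> set p"
    using path_covering_obtain[OF C] by (auto simp: light_iff)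
  have "\<not> ?W \<subseteq> {hd p, last p}"
  proof
    assume "?W \<subseteq> {hd p, last p}"
    then have "card ?W \<le> card {hd p, last p}" by (intro card_mono) auto
    also have "\<dots> \<le> 2" by (simp add: card_insert_if)
    finally show False using three by simp
  qed
  then obtain w2 where w2: "w2 \<in> ?W" "w2 \<notin> {hd p, last p}" by blast
  then obtain q where q: "q \<in> C" "w2 \<in> set q"
    using path_covering_obtain[OF C] by (auto simp: light_iff)
  have pq: "p \<noteq> q" using W_end[OF w2(1) q] w2(2) by blast
  have "w1 \<in> {hd p, last p}" "(w1, v) \<in> parcs G" "p \<noteq> [v]"
    using W_end[OF w1 p] by auto
  \<comment> \<open>\<open>last r = v\<close> holds because the path \<open>[v]\<close> has equal
    ends; it leaves \<open>v\<close> free for the second join, to \<open>w2\<close>.\<close>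
  then obtain r where r: "path_covering G (insert r (C - {p, [v]}))"
    "Suc (card (insert r (C - {p, [v]}))) = card C"
    "set r = set p \<union> set [v]" "last r = v"
    using path_covering_join[OF C p(1) v(1), of w1 v] by auto
  let ?C = "insert r (C - {p, [v]})"
  have "w2 \<in> {hd q, last q}" and vw2: "(v, w2) \<in> parcs G" and qv: "q \<noteq> [v]"
    using W_end[OF w2(1) q] w2(1) by auto
  moreover have "v \<notin> set q" using path_covering_singleton[OF C v(1) q(1)] qv by blast
  then have "r \<noteq> q" using r(3) by auto
  moreover have "r \<in> ?C" "q \<in> ?C" using q(1) pq qv by auto
  moreover have "v \<in> {hd r, last r}" using r(4) by simp
  ultimately obtain s where s: "path_covering G (insert s (?C - {r, q}))"
    "Suc (card (insert s (?C - {r, q}))) = card ?C"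
    using path_covering_join[OF r(1)] vw2 by metis
  show thesis
  proof (rule that[OF s(1)])
    show "card (insert s (?C - {r, q})) + 2 = card C" using r(2) s(2) by simp
  next
    fix x assume x: "heavy G x" "x \<noteq> v" "[x] \<in> C"
    \<comment> \<open>Each path that is removed contains \<open>v\<close> or one of the light
      vertices \<open>w1\<close>, \<open>w2\<close>, so it cannot be \<open>[x]\<close>.\<close>
    have "w1 \<noteq> x" "w2 \<noteq> x" using w1 w2(1) x(1) light_not_heavy by auto
    moreover have "[x] \<noteq> r"
      using r(3) p(2) \<open>w1 \<noteq> x\<close> by (metis UnI1 empty_set list.simps(15) singletonD)
    ultimately show "[x] \<in> insert s (?C - {r, q})" using x p(2) q(2) by auto
  qed
qed

text \<open>Induction on the set \<open>S\<close> of heavy vertices already linked. The invariant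
  that all other heavy vertices are still paths of their own is what
  \<open>attach_heavy_vertex\<close> needs for the next one.\<close>

lemma path_covering_greedy:
  assumes conn: "Digraph_Component.connected (with_proj G)" and nc: "\<not> is_cycle_graph G"
    and three: "\<And>v. heavy G v \<Longrightarrow> card {u. (v, u) \<in> parcs G \<and> light G u} \<ge> 3"
  obtains C where "path_covering G C"
    "card C + card (light_edges G) + 2 * card {v. heavy G v} = card (pverts G)"
proof -
  have "\<exists>C. path_covering G C \<and> (\<forall>v. heavy G v \<and> v \<notin> S \<longrightarrow> [v] \<in> C) \<and>
      card C + card (light_edges G) + 2 * card S = card (pverts G)"
    if "finite S" "S \<subseteq> {v. heavy G v}" for S
    using that
  proof (induction S rule: finite_induct)
    case empty
    then show ?case using initial_covering[OF conn nc] by (metis add.right_neutral card.empty mult_0_right)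
  next
    case (insert v S)
    then obtain C where C: "path_covering G C" "\<And>x. heavy G x \<Longrightarrow> x \<notin> S \<Longrightarrow> [x] \<in> C"
      "card C + card (light_edges G) + 2 * card S = card (pverts G)"
      by auto
    have v: "heavy G v" "[v] \<in> C" using insert C(2) by auto
    obtain D where D: "path_covering G D" "card D + 2 = card C"
      "\<And>x. heavy G x \<Longrightarrow> x \<noteq> v \<Longrightarrow> [x] \<in> C \<Longrightarrow> [x] \<in> D"
      using attach_heavy_vertex[OF C(1) v(2,1) three[OF v(1)]] by blast
    then show ?case
      using insert.hyps C(2,3) by (intro exI[of _ D]) auto
  qed
  from this[OF finite_heavy] show ?thesis using that by blast
qed

section \<open>Counting edge ends at light vertices\<close>

text \<open>An isolated vertex would form a closed set and thus be the only vertex, but an edge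
  needs two.\<close>

lemma nbrs_nonempty:
  assumes conn: "Digraph_Component.connected (with_proj G)" and ne: "uedges G \<noteq> {}"
    and v: "v \<in> pverts G"
  shows "nbrs G v \<noteq> {}"
proof
  assume "nbrs G v = {}"
  then have "pverts G \<subseteq> {v}"
    using connected_closed_set[OF conn, of v "{v}"] v by (auto simp: nbrs_def)
  moreover obtain a b where "(a, b) \<in> parcs G" using ne by (auto simp: uedges_def)
  ultimately show False using in_arcsD1 in_arcsD2 no_loops' by blast
qed

lemma card_incident_edges:
  "card {e \<in> uedges G. v \<in> e} = card (nbrs G v)"
proof -
  have "{e \<in> uedges G. v \<in> e} = (\<lambda>u. {v, u}) ` nbrs G v"
    unfolding uedges_def nbrs_def using arcs_symmetric by (auto simp: insert_commute)
  moreover have "inj_on (\<lambda>u. {v, u}) (nbrs G v)"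
    by (rule inj_onI) (auto simp: doubleton_eq_iff)
  ultimately show ?thesis by (simp add: card_image)
qed

text \<open>Double counting of light edge ends. An edge has 2, 1 or 0 light ends, which is 1, plus 1
  for a light edge, minus 1 for a heavy edge; the latter is moved to the left to stay within the
  naturals.\<close>

lemma sum_light_degree:
  "(\<Sum>v | light G v. card (nbrs G v)) + card (heavy_edges G) = card (light_edges G) + card (uedges G)"
proof -
  have finL: "finite {v. light G v}"
    using pair_finite_verts by (rule rev_finite_subset) (auto simp: light_def)
  have ends: "card {v \<in> {v. light G v}. v \<in> e} + of_bool (e \<in> heavy_edges G)
      = of_bool (e \<in> light_edges G) + 1" if e: "e \<in> uedges G" for e
  proof -
    obtain a b where ab: "e = {a, b}" "a \<noteq> b" "a \<in> pverts G" "b \<in> pverts G"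
      using e no_loops' in_arcsD1 in_arcsD2 unfolding uedges_def by blast
    have eq: "{v \<in> {v. light G v}. v \<in> e} = (if light G a then {a} else {}) \<union> (if light G b then {b} else {})"
      using ab by auto
    show ?thesis
      unfolding eq heavy_edges_def light_edges_def using ab e light_or_heavy light_not_heavy by auto
  qed
  have "(\<Sum>v | light G v. card (nbrs G v)) = (\<Sum>v | light G v. card {e \<in> uedges G. v \<in> e})"
    by (simp add: card_incident_edges)
  also have "\<dots> = (\<Sum>e\<in>uedges G. card {v \<in> {v. light G v}. v \<in> e})"
    using finL finite_uedges by (intro sum_multicount_gen) auto
  finally have "(\<Sum>v | light G v. card (nbrs G v)) = (\<Sum>e\<in>uedges G. card {v \<in> {v. light G v}. v \<in> e})" .
  moreover have "(\<Sum>e\<in>uedges G. card {v \<in> {v. light G v}. v \<in> e} + of_bool (e \<in> heavy_edges G))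
      = (\<Sum>e\<in>uedges G. of_bool (e \<in> light_edges G) + 1)"
    by (rule sum.cong[OF refl ends])
  moreover have "uedges G \<inter> heavy_edges G = heavy_edges G" "uedges G \<inter> light_edges G = light_edges G"
    by (auto simp: heavy_edges_def light_edges_def)
  ultimately show ?thesis using finite_uedges by (simp add: sum.distrib sum_Suc)
qed

text \<open>Without isolated vertices a light vertex has degree 1 or 2, and degree 1 means leaf; so
  its degree plus its leaf indicator is always 2. Every leaf is light, so all leaves are
  counted.\<close>

lemma sum_light_degree_leaves:
  assumes conn: "Digraph_Component.connected (with_proj G)" and ne: "uedges G \<noteq> {}"
  shows "(\<Sum>v | light G v. card (nbrs G v)) + card (leaves G) = 2 * card {v. light G v}"
proof -
  have finL: "finite {v. light G v}"
    using pair_finite_verts by (rule rev_finite_subset) (auto simp: light_def)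
  have deg: "card (nbrs G v) + of_bool (v \<in> leaves G) = 2" if v: "light G v" for v
  proof -
    have "card (nbrs G v) \<noteq> 0" "card (nbrs G v) \<le> 2" "v \<in> pverts G"
      using v nbrs_nonempty[OF conn ne] finite_nbrs by (auto simp: light_iff)
    then show ?thesis by (auto simp: leaves_def degree_eq_card_nbrs)
  qed
  have "Collect (light G) \<inter> leaves G = leaves G"
    by (auto simp: leaves_def light_iff degree_eq_card_nbrs)
  then have "card (leaves G) = (\<Sum>v | light G v. of_bool (v \<in> leaves G))"
    using finL by simp
  then have "(\<Sum>v | light G v. card (nbrs G v)) + card (leaves G)
      = (\<Sum>v | light G v. card (nbrs G v) + of_bool (v \<in> leaves G))"
    by (simp add: sum.distrib)
  then show ?thesis by (simp add: deg)
qed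

lemma card_light_heavy: "card {v. light G v} + card {v. heavy G v} = card (pverts G)"
proof -
  have "pverts G = {v. light G v} \<union> {v. heavy G v}" by (auto simp: light_def heavy_def)
  moreover have "{v. light G v} \<inter> {v. heavy G v} = {}" by (auto simp: light_def)
  ultimately show ?thesis
    using card_Un_disjoint[of "{v. light G v}" "{v. heavy G v}"] pair_finite_verts by simp
qed

end

theorem theorem20:
  fixes G :: "'a pair_pre_digraph"
    and m n h l :: nat
  assumes "pair_graph G"
    and "Digraph_Component.connected (with_proj G)"
    and "\<not> is_cycle_graph G"
    and "m = card (uedges G)"
    and "m \<ge> 1"
    and "n = card (pverts G)"
    and "h = card (heavy_edges G)"
    and "l = card (leaves G)"
    and "\<And>v. heavy G v \<Longrightarrow> card {u. (v, u) \<in> parcs G \<and> light G u} \<ge> 3"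
  shows "int (path_covering_number G) = int l + int m - int h - int n"
proof -
  interpret pair_graph G by fact
  obtain C where C: "path_covering G C"
    "card C + card (light_edges G) + 2 * card {v. heavy G v} = card (pverts G)"
    using path_covering_greedy[OF assms(2,3,9)] by blast
  obtain D where D: "path_covering G D" "card D = path_covering_number G"
    using path_covering_number_attained by blast
  \<comment> \<open>The covering \<open>C\<close> gives one inequality, the lower bound applied to
    the minimum covering \<open>D\<close> the other.\<close>
  have "path_covering_number G + card (light_edges G) + 2 * card {v. heavy G v} = n"
    using path_covering_number_le[OF C(1)] path_covering_card_ge[OF D(1)] C(2) D(2) assms(6)
    by linarith
  moreover have "uedges G \<noteq> {}" using assms(4,5) by auto
  \<comment> \<open>Eliminates the degree sum of the light vertices from its two evaluations.
    Together with \<open>card_light_heavy\<close> this turns the previous equation into the claimed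
    formula.\<close>
  then have "card (light_edges G) + m + l = 2 * card {v. light G v} + h"
    using sum_light_degree sum_light_degree_leaves assms(2,4,7,8) by fastforce
  ultimately show ?thesis using card_light_heavy assms(6) by linarith
qed

end
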